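(* Let $f(x)=c_0+c_1x+c_2x^2+\cdots$ be a formal power series with complex coefficients and $c_0\neq 0$. Then for any two sequences of complex numbers $\{a_n\}_{n\ge1}$ and $\{b_n\}_{n\ge 1}$ the following two conditions are equivalent: $$a_n=n\sum_{m=1}^n[x^{n-m}]f(x)^m\cdot b_m\quad\text{for all } n=1,2,3,\ldots$$ and $$b_n=\frac 1n\sum_{m=1}^n[x^{n-m}]f(x)^{-n}\cdot a_m\quad\text{for all } n=1,2,3,\ldots.$$
   Context: $[x^k]g(x)$ denotes the coefficient of $x^k$ in the power series expansion of $g(x)$. For $c_0\ne 0$ and $n\ge 1$, $f(x)^{-n}$ is the $n$-th power of the multiplicative inverse of $f(x)$ as a power series. *)

theory Defs
  imports Complex_Main "HOL-Computational_Algebra.Formal_Power_Series"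
begin

end

(* The two conditions say a = A b and b = B a for the lower triangular matrices
   A(n,m) = n [x^(n-m)] f^m and B(n,m) = (1/n) [x^(n-m)] f^(-n).
   With j = n - k, the entry (B A)(n,k) is 1/n times the x^j-coefficient of
   f^(-n) (k f^k + x (f^k)') = k (f^(-j) + x f' f^(-j-1)),
   and j x f' f^(-j-1) = - x (f^(-j))' shows that this coefficient vanishes for j > 0.
   So B A = I, and the equivalence follows because B has a nonzero diagonal. *)
theory Submission
  imports Defs
begin

text \<open>Applying \<open>fps_X * fps_deriv\<close> multiplies the coefficient of x^j by j. For
  \<open>inverse f ^ j\<close> the chain rule gives the same coefficient as -j times that of the
  second summand, and j cancels in characteristic 0.\<close>

lemma fps_nth_inverse_power_deriv:
  fixes f :: "'a::field_char_0 fps"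
  assumes "fps_nth f 0 \<noteq> 0" "j > 0"
  shows "fps_nth (inverse f ^ j + fps_X * (fps_deriv f * inverse f ^ Suc j)) j = 0"
proof -
  have "fps_deriv (inverse f ^ j) = of_nat j * inverse f ^ (j - 1) * fps_deriv (inverse f)"
    by (simp add: fps_deriv_power fps_of_nat mult_ac)
  also have "\<dots> = - (of_nat j * (fps_deriv f * (inverse f ^ (j - 1) * inverse f ^ 2)))"
    using assms by (simp add: fps_inverse_deriv mult_ac)
  \<comment> \<open>Since j > 0, the truncated j - 1 is a true predecessor.\<close>
  also have "inverse f ^ (j - 1) * inverse f ^ 2 = inverse f ^ Suc j"
    using assms by (simp flip: power_add)
  finally have "fps_nth (fps_X * fps_deriv (inverse f ^ j)) j =
      - (of_nat j * fps_nth (fps_X * (fps_deriv f * inverse f ^ Suc j)) j)"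
    using \<open>j > 0\<close> by (simp add: fps_of_nat [symmetric])
  moreover have "fps_nth (fps_X * fps_deriv (inverse f ^ j)) j = of_nat j * fps_nth (inverse f ^ j) j"
    using assms by simp
  ultimately have "of_nat j * fps_nth (inverse f ^ j) j =
      - (of_nat j * fps_nth (fps_X * (fps_deriv f * inverse f ^ Suc j)) j)"
    by (simp only:)
  then have "of_nat j * fps_nth (inverse f ^ j + fps_X * (fps_deriv f * inverse f ^ Suc j)) j = 0"
    by (simp only: fps_add_nth distrib_left left_minus)
  then show ?thesis
    using assms by simp
qed

text \<open>This is the entry (n,k) of B A with the factor 1/n cleared. The sum starts at k because
  A is lower triangular; substituting m = i + k turns it into a Cauchy product.\<close>

lemma fps_inverse_power_convolution:
  fixes f :: "'a::field_char_0 fps"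
  assumes "fps_nth f 0 \<noteq> 0" "k \<ge> 1" "k \<le> n"
  shows "(\<Sum>m=k..n. fps_nth (inverse f ^ n) (n - m) * (of_nat m * fps_nth (f ^ k) (m - k))) =
         (if n = k then of_nat n else 0)"
proof -
  define j where "j = n - k"
  then have n: "n = j + k"
    using assms by simp
  have inv: "inverse f * f = 1"
    using assms by (simp add: inverse_mult_eq_1)
  have cancel: "inverse f ^ (i + l) * f ^ l = inverse f ^ i" for i l
    by (simp add: power_add mult.assoc inv flip: power_mult_distrib)
  \<comment> \<open>The series \<open>h\<close> absorbs the weight m = i + k into the coefficients
    of \<open>f ^ k\<close>.\<close>
  define h where "h = of_nat k * f ^ k + fps_X * fps_deriv (f ^ k)"
  have h_nth: "fps_nth h i = of_nat (i + k) * fps_nth (f ^ k) i" for i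
    by (cases i) (simp_all add: h_def algebra_simps fps_of_nat [symmetric])
  have "(\<Sum>m=k..n. fps_nth (inverse f ^ n) (n - m) * (of_nat m * fps_nth (f ^ k) (m - k))) =
        (\<Sum>i=0..j. fps_nth (inverse f ^ n) (j - i) * fps_nth h i)"
    using sum.shift_bounds_cl_nat_ivl
      [of "\<lambda>m. fps_nth (inverse f ^ n) (n - m) * (of_nat m * fps_nth (f ^ k) (m - k))" 0 k j]
    by (simp add: n h_nth)
  also have "\<dots> = fps_nth (h * inverse f ^ n) j"
    by (simp add: fps_mult_nth mult.commute)
  \<comment> \<open>The exponent n is split as j + k and as Suc j + (k - 1), so that
    \<open>cancel\<close> applies to \<open>f ^ k\<close> and to the \<open>f ^ (k - 1)\<close>
    coming from the derivative.\<close>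
  also have "h * inverse f ^ n =
      of_nat k * (inverse f ^ (j + k) * f ^ k
        + fps_X * (fps_deriv f * (inverse f ^ (Suc j + (k - 1)) * f ^ (k - 1))))"
    using assms by (simp add: h_def n fps_deriv_power fps_of_nat algebra_simps)
  also have "\<dots> = of_nat k * (inverse f ^ j + fps_X * (fps_deriv f * inverse f ^ Suc j))"
    by (simp only: cancel)
  also have "fps_nth \<dots> j = of_nat k * fps_nth (inverse f ^ j + fps_X * (fps_deriv f * inverse f ^ Suc j)) j"
    by (simp flip: fps_of_nat)
  also have "\<dots> = (if n = k then of_nat n else 0)"
  \<comment> \<open>For j = 0 the constant term of the bracket is 1, which leaves k = n.\<close>
  proof (cases "j = 0")
    case False
    then show ?thesis
      using fps_nth_inverse_power_deriv [OF assms(1), of j] by (simp add: n)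
  qed (simp add: n)
  finally show ?thesis .
qed

text \<open>Exchanging the sums over the triangle 1 \<le> k \<le> m \<le> n isolates the convolution
  above as the coefficient of \<open>b k\<close>, and only k = n survives.\<close>

lemma fps_inverse_power_inversion:
  fixes f :: "'a::field_char_0 fps"
  assumes "fps_nth f 0 \<noteq> 0" "n \<ge> 1"
  shows "(\<Sum>m=1..n. fps_nth (inverse f ^ n) (n - m) *
            (of_nat m * (\<Sum>k=1..m. fps_nth (f ^ k) (m - k) * b k))) = of_nat n * b n"
proof -
  have "(\<Sum>m=1..n. fps_nth (inverse f ^ n) (n - m) *
            (of_nat m * (\<Sum>k=1..m. fps_nth (f ^ k) (m - k) * b k))) =
        (\<Sum>m=1..n. \<Sum>k=1..m.
            fps_nth (inverse f ^ n) (n - m) * (of_nat m * fps_nth (f ^ k) (m - k)) * b k)"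
    by (simp add: sum_distrib_left mult.assoc)
  also have "\<dots> = (\<Sum>k=1..n. \<Sum>m=k..n.
            fps_nth (inverse f ^ n) (n - m) * (of_nat m * fps_nth (f ^ k) (m - k)) * b k)"
    unfolding sum.Sigma [OF finite_atLeastAtMost ballI [OF finite_atLeastAtMost]]
    by (rule sum.reindex_bij_witness [of _ "\<lambda>(x, y). (y, x)" "\<lambda>(x, y). (y, x)"]) auto
  also have "\<dots> = (\<Sum>k=1..n. (if n = k then of_nat n else 0) * b k)"
    using assms
    by (intro sum.cong refl) (simp add: fps_inverse_power_convolution flip: sum_distrib_right)
  also have "\<dots> = (\<Sum>k=1..n. if n = k then of_nat n * b k else 0)"
    by (intro sum.cong) auto
  also have "\<dots> = of_nat n * b n"
    using assms by (simp add: sum.delta')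
  finally show ?thesis .
qed

text \<open>Injectivity of a lower triangular system: by strong induction the terms with m < n
  agree, and the diagonal entry of row n is the n-th power of the nonzero constant term of
  \<open>g\<close>.\<close>

lemma inverse_power_convolution_cancel:
  fixes g :: "'a::field fps"
  assumes "fps_nth g 0 \<noteq> 0"
    and eq: "\<And>n. n \<ge> 1 \<Longrightarrow>
      (\<Sum>m=1..n. fps_nth (g ^ n) (n - m) * a m) = (\<Sum>m=1..n. fps_nth (g ^ n) (n - m) * c m)"
    and "n \<ge> 1"
  shows "a n = c n"
  using \<open>n \<ge> 1\<close>
proof (induction n rule: less_induct)
  case (less n)
  have ivl: "{1..n} = insert n {1..<n}"
    using less.prems by auto
  have "(\<Sum>m\<in>{1..<n}. fps_nth (g ^ n) (n - m) * a m) = (\<Sum>m\<in>{1..<n}. fps_nth (g ^ n) (n - m) * c m)"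
    using less.IH by (intro sum.cong) auto
  then have "fps_nth (g ^ n) 0 * a n = fps_nth (g ^ n) 0 * c n"
    using eq [OF less.prems] unfolding ivl by simp
  then show ?case
    using assms by (simp add: fps_power_zeroth)
qed

theorem theorem3p2:
  fixes f :: "complex fps" and a b :: "nat \<Rightarrow> complex"
  assumes "fps_nth f 0 \<noteq> 0"
  shows "(\<forall>n\<ge>1. a n = of_nat n * (\<Sum>m=1..n. fps_nth (f ^ m) (n - m) * b m)) \<longleftrightarrow>
         (\<forall>n\<ge>1. b n = 1 / of_nat n * (\<Sum>m=1..n. fps_nth (inverse f ^ n) (n - m) * a m))"
    (is "?A \<longleftrightarrow> ?B")
proof -
  \<comment> \<open>With \<open>c\<close> = A b, the first condition reads a = c on positive
    indices, and B c = b always holds.\<close>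
  define c where "c n = of_nat n * (\<Sum>m=1..n. fps_nth (f ^ m) (n - m) * b m)" for n
  have c: "(\<Sum>m=1..n. fps_nth (inverse f ^ n) (n - m) * c m) = of_nat n * b n" if "n \<ge> 1" for n
    unfolding c_def by (rule fps_inverse_power_inversion [OF assms that])
  have B: "?B \<longleftrightarrow> (\<forall>n\<ge>1. (\<Sum>m=1..n. fps_nth (inverse f ^ n) (n - m) * a m) = of_nat n * b n)"
    by (auto simp: field_simps)
  have "(\<forall>n\<ge>1. a n = c n) \<longleftrightarrow> ?B"
  proof
    assume "\<forall>n\<ge>1. a n = c n"
    then have "(\<Sum>m=1..n. fps_nth (inverse f ^ n) (n - m) * a m) =
        (\<Sum>m=1..n. fps_nth (inverse f ^ n) (n - m) * c m)" for n
      by (intro sum.cong) auto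
    then show ?B
      unfolding B using c by simp
  next
    assume ?B
    \<comment> \<open>Row n sends both \<open>a\<close> and \<open>c\<close> to n times
      \<open>b n\<close>, so injectivity for \<open>inverse f\<close> identifies them.\<close>
    then show "\<forall>n\<ge>1. a n = c n"
      using inverse_power_convolution_cancel [of "inverse f" a c] assms c
      unfolding B by simp
  qed
  then show ?thesis
    by (simp only: c_def)
qed

end
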